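(* Let $(X,d)$ be a metrizable space (with the topology generated by the metric $d$). The following are equivalent: (1) $X$ has the Hurewicz property. (2) $X$ is $\sigma$-totally bounded in each equivalent metric; that is, for every metric $\rho$ on $X$ generating the topology of $X$, the metric space $(X,\rho)$ is $\sigma$-totally bounded.
   Context: A topological space $X$ has the Hurewicz property if for each sequence $(\mathcal{U}_n : n<\infty)$ (indexed by the natural numbers) of open covers of $X$ there is a sequence $(\mathcal{V}_n : n<\infty)$ such that for each $n$, $\mathcal{V}_n$ is a finite subset of $\mathcal{U}_n$, and each element of $X$ is in all but finitely many of the sets $\bigcup\mathcal{V}_n$. A metric space $(Y,\rho)$ is totally bounded if for each $\epsilon>0$ there is a finite set $F\subset Y$ such that $Y\subseteq\bigcup_{f\in F}B_\rho(f,\epsilon)$, where $B_\rho(f,\epsilon)=\{y\in Y : \rho(y,f)<\epsilon\}$. A metric space is $\sigma$-totally bounded if it is a union of countably many subsets, each totally bounded (as a metric space with the restricted metric). *)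

theory Defs
  imports "HOL-Analysis.Analysis"
begin

definition Hurewicz_space :: "'a topology \<Rightarrow> bool" where
  "Hurewicz_space T \<longleftrightarrow>
     (\<forall>\<U> :: nat \<Rightarrow> 'a set set.
        (\<forall>n. (\<forall>U \<in> \<U> n. openin T U) \<and> \<Union>(\<U> n) = topspace T) \<longrightarrow>
        (\<exists>\<V> :: nat \<Rightarrow> 'a set set.
           (\<forall>n. finite (\<V> n) \<and> \<V> n \<subseteq> \<U> n) \<and>
           (\<forall>x \<in> topspace T. finite {n. x \<notin> \<Union>(\<V> n)})))"

context Metric_space
begin

text \<open>The library predicate \<open>mtotally_bounded S\<close> takes the centres of the balls from \<open>S\<close>
  itself, so it is total boundedness of \<open>S\<close> with the restricted metric
  (see also \<open>mtotally_bounded_absolute\<close>).\<close>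

definition sigma_totally_bounded :: bool where
  "sigma_totally_bounded \<longleftrightarrow>
     (\<exists>\<C>. countable \<C> \<and> (\<forall>S \<in> \<C>. mtotally_bounded S) \<and> \<Union>\<C> = M)"

end

end

theory Submission
  imports Defs
begin

text \<open>
  The Hurewicz property gives \<open>\<sigma>\<close>-total boundedness because it can be applied to the covers by balls
  of radius \<open>1/(n+1)\<close>: if \<open>\<V> n\<close> is the selected finite subfamily, then the points that lie in
  \<open>\<Union>(\<V> n)\<close> for all \<open>n \<ge> m\<close> form a totally bounded set, and these sets exhaust the space
  (lemma \<open>Hurewicz_imp_sigma_totally_bounded\<close>).

  For the converse, a sequence of open covers \<open>\<U> n\<close> is encoded in a single equivalent metric in which
  every totally bounded set is covered by finitely many members of each \<open>\<U> n\<close>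
  (lemma \<open>equivalent_metric_for_cover_sequence\<close>). If the space is a countable union of such sets,
  letting \<open>\<V> n\<close> cover the first \<open>n\<close> of them proves the Hurewicz property. The metric arises
  as follows. \<open>\<sigma>\<close>-total boundedness in the original metric makes the space Lindelof, so each
  \<open>\<U> n\<close> has a countable subcover \<open>U 0, U 1, \<dots>\<close>. For it there is a continuous real function \<open>h n\<close>
  whose sublevel sets each lie in a finite union \<open>U 0 \<union> \<dots> \<union> U N\<close>
  (lemma \<open>exhausting_function_of_countable_cover\<close>). Adding to the original metric the distance of
  the sequences \<open>(h n x)\<^sub>n\<close> and \<open>(h n y)\<^sub>n\<close> in the product space of real sequences preserves the
  topology, since every \<open>h n\<close> is continuous, and makes every \<open>h n\<close> uniformly continuous. On a
  totally bounded set each \<open>h n\<close> is therefore bounded, which means that the set lies in a sublevel set.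
\<close>

section \<open>The Hurewicz property implies \<open>\<sigma>\<close>-total boundedness\<close>

context Metric_space
begin

text \<open>Total boundedness asks for centres inside the set itself. Centres elsewhere in the space suffice,
  since each ball that meets the set can be recentred there at the cost of doubling its radius.\<close>

lemma mtotally_bounded_outer_centres:
  assumes "S \<subseteq> M" and net: "\<And>\<epsilon>. 0 < \<epsilon> \<Longrightarrow> \<exists>K. finite K \<and> S \<subseteq> (\<Union>x\<in>K. mball x \<epsilon>)"
  shows "mtotally_bounded S"
  unfolding mtotally_bounded_def
proof (intro allI impI)
  fix \<epsilon> :: real
  assume "0 < \<epsilon>"
  then obtain K where K: "finite K" "S \<subseteq> (\<Union>x\<in>K. mball x (\<epsilon>/2))"
    using net[of "\<epsilon>/2"] by auto
  define K' where "K' = {x \<in> K. mball x (\<epsilon>/2) \<inter> S \<noteq> {}}"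
  have "\<forall>x\<in>K'. \<exists>z. z \<in> mball x (\<epsilon>/2) \<inter> S"
    unfolding K'_def by blast
  then obtain c where c: "\<And>x. x \<in> K' \<Longrightarrow> c x \<in> mball x (\<epsilon>/2) \<inter> S"
    by metis
  have "y \<in> (\<Union>z\<in>c ` K'. mball z \<epsilon>)" if "y \<in> S" for y
  proof -
    obtain x where x: "x \<in> K" "y \<in> mball x (\<epsilon>/2)"
      using K(2) \<open>y \<in> S\<close> by blast
    with \<open>y \<in> S\<close> have "x \<in> K'"
      by (auto simp: K'_def)
    moreover have "y \<in> mball (c x) \<epsilon>"
      using c[OF \<open>x \<in> K'\<close>] x(2) triangle''[of "c x" x y] by (auto simp: commute)
    ultimately show ?thesis
      by blast
  qed
  moreover have "finite (c ` K')" "c ` K' \<subseteq> S"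
    using K(1) c by (auto simp: K'_def)
  ultimately show "\<exists>K. finite K \<and> K \<subseteq> S \<and> S \<subseteq> (\<Union>x\<in>K. mball x \<epsilon>)"
    by blast
qed

text \<open>The points that are covered from stage \<open>m\<close> onwards are covered by finitely many balls of radius
  \<open>1/(n+1)\<close> for all large \<open>n\<close>, hence form a totally bounded set.\<close>

lemma Hurewicz_imp_sigma_totally_bounded:
  assumes "Hurewicz_space mtopology"
  shows sigma_totally_bounded
proof -
  define \<U> where "\<U> n = (\<lambda>x. mball x (inverse (real (Suc n)))) ` M" for n
  have "(\<forall>U \<in> \<U> n. openin mtopology U) \<and> \<Union>(\<U> n) = topspace mtopology" for n
  proof -
    have "x \<in> mball x (inverse (real (Suc n)))" if "x \<in> M" for x
      using that by simp
    then show ?thesis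
      unfolding \<U>_def by auto
  qed
  with assms obtain \<V> where fin: "\<And>n. finite (\<V> n)" and sub: "\<And>n. \<V> n \<subseteq> \<U> n"
    and ev: "\<And>x. x \<in> M \<Longrightarrow> finite {n. x \<notin> \<Union>(\<V> n)}"
    unfolding Hurewicz_space_def by (metis topspace_mtopology)
  define S where "S m = {x \<in> M. \<forall>n\<ge>m. x \<in> \<Union>(\<V> n)}" for m
  have "mtotally_bounded (S m)" for m
  proof (rule mtotally_bounded_outer_centres)
    show "S m \<subseteq> M"
      by (auto simp: S_def)
    fix \<epsilon> :: real
    assume "0 < \<epsilon>"
    then obtain k where k: "inverse (real (Suc k)) < \<epsilon>"
      using reals_Archimedean by blast
    define n where "n = max m k"
    have "inverse (real (Suc n)) \<le> inverse (real (Suc k))"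
      by (rule le_imp_inverse_le) (auto simp: n_def)
    with k have n: "inverse (real (Suc n)) \<le> \<epsilon>"
      by linarith
    obtain K where K: "K \<subseteq> M" "finite K" "\<V> n = (\<lambda>x. mball x (inverse (real (Suc n)))) ` K"
      using finite_subset_image[OF fin sub[of n, unfolded \<U>_def]] by blast
    have "S m \<subseteq> \<Union>(\<V> n)"
      by (auto simp: S_def n_def)
    also have "\<dots> \<subseteq> (\<Union>x\<in>K. mball x \<epsilon>)"
      unfolding K(3) using mball_subset_concentric[OF n] by blast
    finally show "\<exists>K. finite K \<and> S m \<subseteq> (\<Union>x\<in>K. mball x \<epsilon>)"
      using K(2) by blast
  qed
  moreover have "x \<in> \<Union>(range S)" if "x \<in> M" for x
  proof -
    obtain m where "\<forall>n \<in> {n. x \<notin> \<Union>(\<V> n)}. n < m"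
      using ev[OF \<open>x \<in> M\<close>] unfolding finite_nat_set_iff_bounded ..
    then have "x \<in> \<Union>(\<V> n)" if "m \<le> n" for n
      using that linorder_not_le by blast
    with \<open>x \<in> M\<close> have "x \<in> S m"
      by (simp add: S_def)
    then show ?thesis
      by blast
  qed
  then have "\<Union>(range S) = M"
    by (auto simp: S_def)
  ultimately show ?thesis
    unfolding sigma_totally_bounded_def by (intro exI[of _ "range S"]) auto
qed

section \<open>Encoding open covers in an equivalent metric\<close>

text \<open>Finite \<open>1/(j+1)\<close>-nets of the countably many pieces provide a countable base of balls.\<close>

lemma sigma_totally_bounded_imp_Lindelof_space:
  assumes sigma_totally_bounded
  shows "Lindelof_space mtopology"
proof -
  obtain \<C> where \<C>: "countable \<C>" "\<And>S. S \<in> \<C> \<Longrightarrow> mtotally_bounded S" "\<Union>\<C> = M"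
    using assms unfolding sigma_totally_bounded_def by blast
  have "\<forall>S\<in>\<C>. \<forall>j. \<exists>K. finite K \<and> S \<subseteq> (\<Union>x\<in>K. mball x (inverse (real (Suc j))))"
    using \<C>(2) unfolding mtotally_bounded_def by (metis inverse_positive_iff_positive of_nat_0_less_iff zero_less_Suc)
  then obtain K where K: "\<And>S j. S \<in> \<C> \<Longrightarrow> finite (K S j)"
    "\<And>S j. S \<in> \<C> \<Longrightarrow> S \<subseteq> (\<Union>x\<in>K S j. mball x (inverse (real (Suc j))))"
    by metis
  define \<B> where "\<B> = (\<Union>S\<in>\<C>. \<Union>j. (\<lambda>x. mball x (inverse (real (Suc j)))) ` K S j)"
  have "countable \<B>"
    unfolding \<B>_def using \<C>(1) K(1) by (intro countable_UN countable_image) (auto intro: countable_finite)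
  moreover have "openin mtopology B" if "B \<in> \<B>" for B
    using that by (auto simp: \<B>_def)
  moreover have "\<exists>B\<in>\<B>. x \<in> B \<and> B \<subseteq> U" if "openin mtopology U" "x \<in> U" for U x
  proof -
    obtain r where r: "r > 0" "mball x r \<subseteq> U"
      using \<open>openin mtopology U\<close> \<open>x \<in> U\<close> openin_mtopology by blast
    have "x \<in> M"
      using that openin_mtopology by blast
    obtain j where j: "inverse (real (Suc j)) < r/2"
      using r(1) reals_Archimedean[of "r/2"] by auto
    obtain S where S: "S \<in> \<C>" "x \<in> S"
      using \<C>(3) \<open>x \<in> M\<close> by blast
    then obtain c where c: "c \<in> K S j" "x \<in> mball c (inverse (real (Suc j)))"
      using K(2) by blast
    have "mball c (inverse (real (Suc j))) \<subseteq> mball x r"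
      by (rule mball_subset) (use c(2) j \<open>x \<in> M\<close> in auto)
    then show ?thesis
      using r(2) c S unfolding \<B>_def by blast
  qed
  ultimately have "second_countable mtopology"
    unfolding second_countable_def by blast
  then show ?thesis
    by (rule second_countable_imp_Lindelof_space)
qed

lemma continuous_Lipschitz_1:
  fixes s :: "'a \<Rightarrow> real"
  assumes "\<And>x y. x \<in> M \<Longrightarrow> y \<in> M \<Longrightarrow> s x \<le> s y + d x y"
  shows "continuous_map mtopology euclideanreal s"
proof -
  have "continuous_map mtopology Met_TC.mtopology s"
    unfolding Met_TC.continuous_map_to_metric
  proof (intro ballI allI impI)
    fix x and \<epsilon> :: real
    assume "x \<in> topspace mtopology" "0 < \<epsilon>"
    moreover have "s y \<in> Met_TC.mball (s x) \<epsilon>" if "y \<in> mball x \<epsilon>" for y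
      using that assms[of x y] assms[of y x] commute[of x y] by (auto simp: dist_real_def)
    ultimately show "\<exists>U. openin mtopology U \<and> x \<in> U \<and> (\<forall>y\<in>U. s y \<in> Met_TC.mball (s x) \<epsilon>)"
      by (intro exI[of _ "mball x \<epsilon>"]) auto
  qed
  then show ?thesis
    by simp
qed

text \<open>The function sought is \<open>1/s\<close>, where \<open>s x\<close> is the supremum of the radii \<open>r \<le> 1\<close> such that the ball
  of radius \<open>r\<close> about \<open>x\<close> lies in some \<open>U k\<close> whose index is at most \<open>1/r\<close>. It is positive because the
  sets \<open>U k\<close> are open and cover the space. It is 1-Lipschitz because shrinking an admissible radius at
  \<open>x\<close> by \<open>d x y\<close> gives an admissible radius at \<open>y\<close>: the smaller radius only relaxes the condition on
  the index. A lower bound on \<open>s x\<close> bounds the index of some \<open>U k\<close> that contains \<open>x\<close>.\<close>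

lemma exhausting_function_of_countable_cover:
  fixes U :: "nat \<Rightarrow> 'a set"
  assumes op: "\<And>k. openin mtopology (U k)" and cov: "M \<subseteq> (\<Union>k. U k)"
  obtains h :: "'a \<Rightarrow> real" where "continuous_map mtopology euclideanreal h"
    and "\<And>B. \<exists>N. \<forall>x\<in>M. h x \<le> B \<longrightarrow> x \<in> (\<Union>k\<le>N. U k)"
proof
  \<comment> \<open>The condition \<open>k \<le> 1/r\<close> is multiplied out, so that \<open>r = 0\<close> (empty ball) is admissible and
    \<open>R x\<close> is nonempty.\<close>
  define R where "R x = {r. 0 \<le> r \<and> r \<le> 1 \<and> (\<exists>k. mball x r \<subseteq> U k \<and> real k * r \<le> 1)}" for x
  define s where "s x = Sup (R x)" for x
  have bdd: "bdd_above (R x)" for x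
    by (rule bdd_aboveI[of _ 1]) (auto simp: R_def)
  have zero_in: "0 \<in> R x" for x
    using mball_eq_empty[of x 0] by (auto simp: R_def)
  have le_s: "r \<le> s x" if "r \<in> R x" for r x
    unfolding s_def using that bdd by (rule cSup_upper)
  have "s x \<le> s y + d x y" if "x \<in> M" "y \<in> M" for x y
    unfolding s_def[of x]
  proof (rule cSup_least)
    show "R x \<noteq> {}"
      using zero_in by blast
    fix r
    assume "r \<in> R x"
    then obtain k where k: "0 \<le> r" "r \<le> 1" "mball x r \<subseteq> U k" "real k * r \<le> 1"
      by (auto simp: R_def)
    show "r \<le> s y + d x y"
    proof (cases "d x y \<le> r")
      case True
      have "mball y (r - d x y) \<subseteq> mball x r"
        by (rule mball_subset) (use that commute[of x y] in auto)
      moreover have "real k * (r - d x y) \<le> real k * r"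
        by (rule mult_left_mono) auto
      moreover have "r - d x y \<le> 1"
        using k(2) nonneg[of x y] by linarith
      ultimately have "r - d x y \<in> R y"
        unfolding R_def using True k by fastforce
      then show ?thesis
        using le_s by fastforce
    next
      case False
      then show ?thesis
        using le_s[OF zero_in[of y]] by linarith
    qed
  qed
  then have cont: "continuous_map mtopology euclideanreal s"
    by (rule continuous_Lipschitz_1)
  have pos: "0 < s x" if x: "x \<in> M" for x
  proof -
    obtain k where "x \<in> U k"
      using cov x by blast
    then obtain r where r: "r > 0" "mball x r \<subseteq> U k"
      using op openin_mtopology by blast
    define t where "t = min r (inverse (real (Suc k)))"
    have t: "t \<le> inverse (real (Suc k))" "t \<le> r" "0 < t"
      using r by (auto simp: t_def)
    have "real k * t \<le> real (Suc k) * inverse (real (Suc k))"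
      by (rule mult_mono) (use t in auto)
    then have "real k * t \<le> 1"
      by simp
    moreover have "inverse (real (Suc k)) \<le> 1"
      by (simp add: inverse_le_1_iff)
    moreover have "mball x t \<subseteq> U k"
      using r(2) t(2) by (meson mball_subset_concentric order_trans)
    ultimately have "t \<in> R x"
      unfolding R_def using t by auto
    then show ?thesis
      using le_s t(3) by fastforce
  qed
  show "continuous_map mtopology euclideanreal (\<lambda>x. inverse (s x))"
    using pos by (intro continuous_map_real_inverse cont) fastforce
  show "\<exists>N. \<forall>x\<in>M. inverse (s x) \<le> B \<longrightarrow> x \<in> (\<Union>k\<le>N. U k)" for B
  proof -
    obtain N where N: "2 * \<bar>B\<bar> \<le> real N"
      using real_arch_simple by blast
    have "x \<in> (\<Union>k\<le>N. U k)" if "x \<in> M" and B: "inverse (s x) \<le> B" for x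
    proof -
      \<comment> \<open>The supremum need not be attained, hence the factor 2 in the choice of \<open>N\<close>.\<close>
      have "s x / 2 < s x"
        using pos \<open>x \<in> M\<close> by simp
      then obtain r where r: "r \<in> R x" "s x / 2 < r"
        using less_cSup_iff[OF _ bdd] zero_in unfolding s_def by (metis empty_iff)
      then obtain k where k: "mball x r \<subseteq> U k" "real k * r \<le> 1"
        by (auto simp: R_def)
      have "r > 0"
        using r pos[OF \<open>x \<in> M\<close>] by linarith
      have "real k \<le> inverse r"
        using k(2) \<open>r > 0\<close> by (simp add: field_simps)
      also have "\<dots> \<le> inverse (s x / 2)"
        by (rule le_imp_inverse_le) (use r pos[OF \<open>x \<in> M\<close>] in auto)
      also have "\<dots> = 2 * inverse (s x)"
        by (simp only: divide_inverse inverse_mult_distrib inverse_inverse_eq mult.commute)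
      also have "\<dots> \<le> real N"
        using B N by linarith
      finally have "k \<le> N"
        by simp
      then show ?thesis
        using k(1) \<open>r > 0\<close> \<open>x \<in> M\<close> by auto
    qed
    then show ?thesis
      by blast
  qed
qed

text \<open>The sum dominates \<open>d\<close>, so its topology is at least as fine. It is no finer because, by
  continuity of \<open>f\<close>, its second summand is small on small \<open>d\<close>-balls.\<close>

lemma
  fixes f :: "'a \<Rightarrow> 'b::metric_space"
  shows Metric_space_add_pullback: "Metric_space M (\<lambda>x y. d x y + dist (f x) (f y))"
    and mtopology_add_pullback: "continuous_map mtopology euclidean f \<Longrightarrow>
      Metric_space.mtopology M (\<lambda>x y. d x y + dist (f x) (f y)) = mtopology"
proof -
  let ?\<rho> = "\<lambda>x y. d x y + dist (f x) (f y)"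
  show "Metric_space M ?\<rho>"
  proof
    show "?\<rho> x y = 0 \<longleftrightarrow> x = y" if "x \<in> M" "y \<in> M" for x y
      using that by (smt (verit, best) dist_self mdist_zero nonneg zero zero_le_dist)
    show "?\<rho> x z \<le> ?\<rho> x y + ?\<rho> y z" if "x \<in> M" "y \<in> M" "z \<in> M" for x y z
      using triangle[OF that] dist_triangle[of "f x" "f z" "f y"] by linarith
  qed (auto simp: commute dist_commute)
  then interpret \<rho>: Metric_space M ?\<rho> .
  assume "continuous_map mtopology euclidean f"
  then have cont: "continuous_map mtopology Met_TC.mtopology f"
    by simp
  have "openin \<rho>.mtopology W \<longleftrightarrow> openin mtopology W" for W
  proof
    assume W: "openin mtopology W"
    have "\<rho>.mball x r \<subseteq> mball x r" for x r
    proof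
      fix y
      assume "y \<in> \<rho>.mball x r"
      then show "y \<in> mball x r"
        using zero_le_dist[of "f x" "f y"] by (auto simp del: zero_le_dist)
    qed
    with W show "openin \<rho>.mtopology W"
      unfolding \<rho>.openin_mtopology openin_mtopology by (meson order_trans)
  next
    assume W: "openin \<rho>.mtopology W"
    have "\<exists>r>0. mball x r \<subseteq> W" if "x \<in> W" for x
    proof -
      obtain \<epsilon> where \<epsilon>: "\<epsilon> > 0" "\<rho>.mball x \<epsilon> \<subseteq> W"
        using W \<open>x \<in> W\<close> \<rho>.openin_mtopology by blast
      have "x \<in> M"
        using W \<open>x \<in> W\<close> \<rho>.openin_mtopology by blast
      then obtain V where V: "openin mtopology V" "x \<in> V" "\<And>y. y \<in> V \<Longrightarrow> dist (f x) (f y) < \<epsilon>/2"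
        using cont \<epsilon>(1) unfolding Met_TC.continuous_map_to_metric
        by (metis Met_TC.in_mball half_gt_zero topspace_mtopology)
      then obtain r where r: "r > 0" "mball x r \<subseteq> V"
        using openin_mtopology by blast
      have "y \<in> \<rho>.mball x \<epsilon>" if "y \<in> mball x (min r (\<epsilon>/2))" for y
      proof -
        have "y \<in> V"
          using that r(2) by auto
        from V(3)[OF this] that show ?thesis
          by auto
      qed
      then have "mball x (min r (\<epsilon>/2)) \<subseteq> W"
        using \<epsilon>(2) by blast
      moreover have "0 < min r (\<epsilon>/2)"
        using r(1) \<epsilon>(1) by simp
      ultimately show ?thesis
        by blast
    qed
    with W show "openin mtopology W"
      unfolding \<rho>.openin_mtopology openin_mtopology by blast
  qed
  then show "\<rho>.mtopology = mtopology"
    by (simp add: topology_eq)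
qed

text \<open>A real function that varies by less than 1 on balls of one fixed radius is bounded on any set
  covered by finitely many such balls.\<close>

lemma mtotally_bounded_imp_bdd_above:
  fixes h :: "'a \<Rightarrow> real"
  assumes "mtotally_bounded A" "\<epsilon> > 0"
    and close: "\<And>x y. x \<in> M \<Longrightarrow> y \<in> M \<Longrightarrow> d x y < \<epsilon> \<Longrightarrow> dist (h x) (h y) < 1"
  obtains B where "\<And>x. x \<in> A \<Longrightarrow> h x \<le> B"
proof -
  obtain K where K: "finite K" "A \<subseteq> (\<Union>x\<in>K. mball x \<epsilon>)"
    using assms(1,2) unfolding mtotally_bounded_def by blast
  have "h x \<le> (\<Sum>c\<in>K. \<bar>h c\<bar>) + 1" if "x \<in> A" for x
  proof -
    obtain c where c: "c \<in> K" "x \<in> mball c \<epsilon>"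
      using K(2) \<open>x \<in> A\<close> by blast
    then have "dist (h c) (h x) < 1"
      using close by auto
    then have "h x \<le> \<bar>h c\<bar> + 1"
      by (auto simp: dist_real_def)
    also have "\<bar>h c\<bar> \<le> (\<Sum>c\<in>K. \<bar>h c\<bar>)"
      using K(1) c(1) by (intro member_le_sum) auto
    finally show ?thesis
      by simp
  qed
  then show ?thesis
    using that by blast
qed

end

text \<open>The metric on a countable product is a sum of truncated coordinate distances in which coordinate
  \<open>i\<close> has weight \<open>(1/2) ^ to_nat i\<close>. The bound 1 is the truncation threshold; it makes
  every coordinate uniformly continuous in the form that \<open>mtotally_bounded_imp_bdd_above\<close> uses.\<close>

lemma coordinate_dist_less_1:
  fixes x y :: "'i::countable \<Rightarrow> 'b::metric_space"
  assumes "dist x y < (1/2) ^ to_nat i"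
  shows "dist (x i) (y i) < 1"
proof -
  let ?a = "\<lambda>n. (1/2) ^ n * min (dist (x (from_nat n)) (y (from_nat n))) 1"
  have "summable ?a"
    by (rule summable_comparison_test'[of "\<lambda>n. (1/2)^n"]) (auto simp: summable_geometric_iff)
  from sum_le_suminf[OF this, of "{to_nat i}"]
  have "(1/2) ^ to_nat i * min (dist (x i) (y i)) 1 \<le> dist x y"
    by (simp add: dist_fun_def)
  with assms have "(1/2) ^ to_nat i * min (dist (x i) (y i)) 1 < (1/2) ^ to_nat i * (1::real)"
    by linarith
  then have "min (dist (x i) (y i)) 1 < 1"
    by (subst (asm) mult_less_cancel_left_pos) simp_all
  then show ?thesis
    by linarith
qed

context Metric_space
begin

text \<open>The new metric adds to \<open>d\<close> the distance of the sequences of values \<open>h n\<close>, where \<open>h n\<close> is an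
  exhausting function for a countable subcover of \<open>\<U> n\<close>. A set that is totally bounded in it has all
  \<open>h n\<close> bounded and so is finitely covered from each \<open>\<U> n\<close>.\<close>

lemma equivalent_metric_for_cover_sequence:
  fixes \<U> :: "nat \<Rightarrow> 'a set set"
  assumes "Lindelof_space mtopology"
    and op: "\<And>n U. U \<in> \<U> n \<Longrightarrow> openin mtopology U" and cov: "\<And>n. \<Union>(\<U> n) = M"
  obtains \<rho> where "Metric_space M \<rho>" "Metric_space.mtopology M \<rho> = mtopology"
    and "\<And>A n. Metric_space.mtotally_bounded M \<rho> A \<Longrightarrow> \<exists>\<F>. finite \<F> \<and> \<F> \<subseteq> \<U> n \<and> A \<subseteq> \<Union>\<F>"
proof -
  have "\<exists>h. continuous_map mtopology euclideanreal h \<and>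
      (\<forall>B. \<exists>\<F>. finite \<F> \<and> \<F> \<subseteq> \<U> n \<and> {x \<in> M. h x \<le> B} \<subseteq> \<Union>\<F>)" for n
  proof (cases "M = {}")
    case True
    then show ?thesis
      by (intro exI[of _ "\<lambda>_. 0"]) auto
  next
    case False
    obtain \<W> where \<W>: "countable \<W>" "\<W> \<subseteq> \<U> n" "\<Union>\<W> = M"
      using assms(1) op cov unfolding Lindelof_space_def by (metis topspace_mtopology)
    then have range: "range (from_nat_into \<W>) = \<W>"
      using False by (intro range_from_nat_into) auto
    then have in\<U>: "from_nat_into \<W> k \<in> \<U> n" for k
      using \<W>(2) by blast
    have "openin mtopology (from_nat_into \<W> k)" for k
      using op in\<U> by blast
    moreover have "M \<subseteq> (\<Union>k. from_nat_into \<W> k)"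
      by (simp only: range \<W>(3) order_refl)
    ultimately obtain h where h: "continuous_map mtopology euclideanreal h"
      "\<And>B. \<exists>N. \<forall>x\<in>M. h x \<le> B \<longrightarrow> x \<in> (\<Union>k\<le>N. from_nat_into \<W> k)"
      by (rule exhausting_function_of_countable_cover) blast
    have "\<exists>\<F>. finite \<F> \<and> \<F> \<subseteq> \<U> n \<and> {x \<in> M. h x \<le> B} \<subseteq> \<Union>\<F>" for B
    proof -
      obtain N where "\<forall>x\<in>M. h x \<le> B \<longrightarrow> x \<in> (\<Union>k\<le>N. from_nat_into \<W> k)"
        using h(2) by blast
      then show ?thesis
        using in\<U> by (intro exI[of _ "from_nat_into \<W> ` {..N}"]) auto
    qed
    with h(1) show ?thesis
      by blast
  qed
  then obtain h where h: "\<And>n. continuous_map mtopology euclideanreal (h n)"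
    "\<And>n B. \<exists>\<F>. finite \<F> \<and> \<F> \<subseteq> \<U> n \<and> {x \<in> M. h n x \<le> B} \<subseteq> \<Union>\<F>"
    by metis
  define H where "H x = (\<lambda>n. h n x)" for x
  have "continuous_map mtopology euclidean H"
    using h(1) by (simp add: H_def continuous_map_componentwise_UNIV flip: euclidean_product_topology)
  define \<rho> where "\<rho> x y = d x y + dist (H x) (H y)" for x y
  show thesis
  proof
    show "Metric_space M \<rho>" "Metric_space.mtopology M \<rho> = mtopology"
      unfolding \<rho>_def using Metric_space_add_pullback mtopology_add_pullback
        \<open>continuous_map mtopology euclidean H\<close> by blast+
    then interpret \<rho>: Metric_space M \<rho> 
      by blast
    fix A n
    assume A: "\<rho>.mtotally_bounded A"
    have "dist (h n x) (h n y) < 1" if "\<rho> x y < (1/2) ^ to_nat n" for x y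
    proof -
      have "dist (H x) (H y) < (1/2) ^ to_nat n"
        using that nonneg[of x y] unfolding \<rho>_def by linarith
      from coordinate_dist_less_1[OF this] show ?thesis
        by (simp add: H_def)
    qed
    then obtain B where "\<And>x. x \<in> A \<Longrightarrow> h n x \<le> B"
      using \<rho>.mtotally_bounded_imp_bdd_above[OF A, of "(1/2) ^ to_nat n" "h n"] by auto
    then have "A \<subseteq> {x \<in> M. h n x \<le> B}"
      using \<rho>.mtotally_bounded_imp_subset[OF A] by blast
    with h(2) show "\<exists>\<F>. finite \<F> \<and> \<F> \<subseteq> \<U> n \<and> A \<subseteq> \<Union>\<F>"
      by (meson order_trans)
  qed
qed

end

section \<open>The characterization\<close>

text \<open>Enumerate the pieces and let \<open>\<V> n\<close> cover those with index at most \<open>n\<close>: then each point is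
  missed only at stages before the index of a piece that contains it.\<close>

lemma Hurewicz_selection_of_countable_pieces:
  fixes \<U> :: "nat \<Rightarrow> 'a set set"
  assumes "countable \<C>"
    and fin: "\<And>A n. A \<in> \<C> \<Longrightarrow> \<exists>\<F>. finite \<F> \<and> \<F> \<subseteq> \<U> n \<and> A \<subseteq> \<Union>\<F>"
  obtains \<V> where "\<And>n. finite (\<V> n)" "\<And>n. \<V> n \<subseteq> \<U> n"
    and "\<And>x. x \<in> \<Union>\<C> \<Longrightarrow> finite {n. x \<notin> \<Union>(\<V> n)}"
proof -
  obtain \<F> where \<F>: "\<And>A n. A \<in> \<C> \<Longrightarrow> finite (\<F> A n)" "\<And>A n. A \<in> \<C> \<Longrightarrow> \<F> A n \<subseteq> \<U> n"
    "\<And>A n. A \<in> \<C> \<Longrightarrow> A \<subseteq> \<Union>(\<F> A n)"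
    using fin by metis
  define P where "P n = {A \<in> \<C>. to_nat_on \<C> A \<le> n}" for n
  have "inj_on (to_nat_on \<C>) (P n)" for n
    using inj_on_to_nat_on[OF assms(1)] by (rule inj_on_subset) (auto simp: P_def)
  then have finP: "finite (P n)" for n
    by (rule inj_on_finite[where B="{..n}"]) (auto simp: P_def)
  define \<V> where "\<V> n = (\<Union>A\<in>P n. \<F> A n)" for n
  show thesis
  proof
    show "finite (\<V> n)" for n
      unfolding \<V>_def by (rule finite_UN_I[OF finP]) (auto simp: P_def \<F>(1))
    show "\<V> n \<subseteq> \<U> n" for n
      using \<F>(2) unfolding \<V>_def P_def by blast
    show "finite {n. x \<notin> \<Union>(\<V> n)}" if "x \<in> \<Union>\<C>" for x
    proof -
      obtain A where A: "A \<in> \<C>" "x \<in> A"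
        using \<open>x \<in> \<Union>\<C>\<close> by blast
      have "x \<in> \<Union>(\<V> n)" if "to_nat_on \<C> A \<le> n" for n
        using A \<F>(3)[OF A(1), of n] that unfolding \<V>_def P_def by blast
      then have "{n. x \<notin> \<Union>(\<V> n)} \<subseteq> {..<to_nat_on \<C> A}"
        using linorder_not_le by blast
      then show ?thesis
        by (rule finite_subset) simp
    qed
  qed
qed

theorem theorem1:
  fixes X :: "'a set" and d :: "'a \<Rightarrow> 'a \<Rightarrow> real"
  assumes "Metric_space X d"
  shows "Hurewicz_space (Metric_space.mtopology X d) \<longleftrightarrow>
    (\<forall>\<rho>. Metric_space X \<rho> \<and> Metric_space.mtopology X \<rho> = Metric_space.mtopology X d \<longrightarrow>
       Metric_space.sigma_totally_bounded X \<rho>)"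
proof
  assume Hurewicz: "Hurewicz_space (Metric_space.mtopology X d)"
  show "\<forall>\<rho>. Metric_space X \<rho> \<and> Metric_space.mtopology X \<rho> = Metric_space.mtopology X d \<longrightarrow>
       Metric_space.sigma_totally_bounded X \<rho>"
  proof (intro allI impI, elim conjE)
    fix \<rho>
    assume "Metric_space X \<rho>" and "Metric_space.mtopology X \<rho> = Metric_space.mtopology X d"
    with Hurewicz show "Metric_space.sigma_totally_bounded X \<rho>"
      by (simp add: Metric_space.Hurewicz_imp_sigma_totally_bounded)
  qed
next
  interpret Metric_space X d
    by fact
  assume stb: "\<forall>\<rho>. Metric_space X \<rho> \<and> Metric_space.mtopology X \<rho> = mtopology \<longrightarrow>
       Metric_space.sigma_totally_bounded X \<rho>"
  then have Lindelof: "Lindelof_space mtopology"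
    using assms by (intro sigma_totally_bounded_imp_Lindelof_space) simp
  show "Hurewicz_space mtopology"
    unfolding Hurewicz_space_def
  proof (intro allI impI)
    fix \<U> :: "nat \<Rightarrow> 'a set set"
    assume \<U>: "\<forall>n. (\<forall>U \<in> \<U> n. openin mtopology U) \<and> \<Union>(\<U> n) = topspace mtopology"
    then have op: "\<And>n U. U \<in> \<U> n \<Longrightarrow> openin mtopology U" and cov: "\<And>n. \<Union>(\<U> n) = X"
      by simp_all
    obtain \<rho> where \<rho>: "Metric_space X \<rho>" "Metric_space.mtopology X \<rho> = mtopology"
      and small: "\<And>A n. Metric_space.mtotally_bounded X \<rho> A \<Longrightarrow>
        \<exists>\<F>. finite \<F> \<and> \<F> \<subseteq> \<U> n \<and> A \<subseteq> \<Union>\<F>"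
      by (rule equivalent_metric_for_cover_sequence[where \<U>=\<U>, OF Lindelof op cov]) blast+
    obtain \<C> where \<C>: "countable \<C>" "\<And>A. A \<in> \<C> \<Longrightarrow> Metric_space.mtotally_bounded X \<rho> A" "\<Union>\<C> = X"
      using stb[rule_format, OF conjI, OF \<rho>] unfolding Metric_space.sigma_totally_bounded_def[OF \<rho>(1)]
      by blast
    obtain \<V> where "\<And>n. finite (\<V> n)" "\<And>n. \<V> n \<subseteq> \<U> n"
      "\<And>x. x \<in> \<Union>\<C> \<Longrightarrow> finite {n. x \<notin> \<Union>(\<V> n)}"
      by (rule Hurewicz_selection_of_countable_pieces[where \<U>=\<U>, OF \<C>(1) small[OF \<C>(2)]]) blast+
    then show "\<exists>\<V>. (\<forall>n. finite (\<V> n) \<and> \<V> n \<subseteq> \<U> n) \<and>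
        (\<forall>x \<in> topspace mtopology. finite {n. x \<notin> \<Union>(\<V> n)})"
      using \<C>(3) by (intro exI[of _ \<V>]) auto
  qed
qed

end
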